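(* Let $\{W_j\}_{j\in J}$ be an $f$-basis for $\mathcal{H}$ with $f$-dual sequence $\{P_{W_j}\}_{j\in J}$. Then $P_{W_j}\in B(\mathcal{H},W_j)$ for every $j\in J$ (i.e. each $P_{W_j}$ is a bounded linear operator), and $P_{W_i}P_{W_j}=\delta_{ij}P_{W_j}$ for all $i,j\in J$, where $\delta_{ij}$ is the Kronecker delta.
   Context: $\mathcal{H}$ is a separable Hilbert space and $J$ is a countable (or finite) index set. A sequence $\{W_j\}_{j\in J}$ of closed subspaces of $\mathcal{H}$ is an $f$-basis (fusion Schauder basis) for $\mathcal{H}$ if for every $f\in\mathcal{H}$ there exists a unique sequence $\{g_j\}_{j\in J}$ with $g_j\in W_j$ such that $f=\sum_{j\in J}g_j$, with convergence in norm. In that case, for each $j$ the linear map $P_{W_j}:\mathcal{H}\to W_j$ is defined by $P_{W_j}f=g_j$, so that $f=\sum_{j\in J}P_{W_j}f$; the sequence $\{P_{W_j}\}_{j\in J}$ is called the $f$-dual sequence of $\{W_j\}_{j\in J}$. *)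

theory Defs
  imports "HOL-Analysis.Analysis"
begin

text \<open>
  Hilbert spaces over the reals and over the complex numbers are treated together: by the Gelfand-Mazur
  theorem the only instances of the class \<^class>\<open>real_normed_field\<close> are, up to isomorphism, the reals
  and the complex numbers.  Conjugation is determined by \<open>z * conj z = \<bar>z\<bar>\<^sup>2\<close>; at zero,
  the convention \<open>x / 0 = 0\<close> gives the right value.
\<close>

definition sconj :: "'k::real_normed_field \<Rightarrow> 'k"
  where "sconj z = of_real ((norm z)\<^sup>2) / z"

lemma sconj_real: "sconj (r::real) = r"
  by (simp add: sconj_def power2_eq_square)

lemma sconj_complex: "sconj (z::complex) = cnj z"
  by (cases "z = 0") (simp_all add: sconj_def complex_norm_square del: of_real_power)

text \<open>Norm, topology and completeness come from the class \<^class>\<open>banach\<close>; the inner product is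
  linear in the first argument and induces that norm.\<close>

locale hilbert_space = vector_space smul
  for smul :: "'k::real_normed_field \<Rightarrow> 'h::banach \<Rightarrow> 'h" +
  fixes ip :: "'h \<Rightarrow> 'h \<Rightarrow> 'k"
  assumes smul_of_real: "smul (of_real r) x = r *\<^sub>R x"
    and ip_add_left: "ip (x + y) z = ip x z + ip y z"
    and ip_smul_left: "ip (smul a x) y = a * ip x y"
    and ip_commute: "ip y x = sconj (ip x y)"
    and ip_self: "ip x x = of_real ((norm x)\<^sup>2)"

lemma hilbert_space_real:
  "hilbert_space (scaleR :: real \<Rightarrow> 'a \<Rightarrow> 'a::{real_inner, banach}) inner"
  by unfold_locales
    (auto simp: sconj_real scaleR_add_right scaleR_add_left inner_add_left
      power2_norm_eq_inner intro: inner_commute)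

lemma hilbert_space_complex: "hilbert_space ((*) :: complex \<Rightarrow> _) (\<lambda>x y. x * cnj y)"
  by unfold_locales
    (auto simp: sconj_complex algebra_simps scaleR_conv_of_real complex_norm_square simp del: of_real_power)

definition separable :: "'h::topological_space set \<Rightarrow> bool"
  where "separable S \<longleftrightarrow> (\<exists>D. countable D \<and> D \<subseteq> S \<and> S \<subseteq> closure D)"

text \<open>The bounded \<open>'k\<close>-linear operators from the whole space into the subspace \<open>W\<close>.\<close>

definition bounded_operators ::
    "('k::real_normed_field \<Rightarrow> 'h::banach \<Rightarrow> 'h) \<Rightarrow> 'h set \<Rightarrow> ('h \<Rightarrow> 'h) set"
  where "bounded_operators smul W =
    {T. Vector_Spaces.linear smul smul T \<and> range T \<subseteq> W \<and> (\<exists>K. \<forall>x. norm (T x) \<le> K * norm x)}"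

text \<open>
  A countable (finite or infinite) index set \<open>J\<close> comes with an injection \<open>pos\<close> into the naturals,
  which fixes the order of summation.  Convergence is that of the partial sums in this order, as
  for Schauder bases; no unconditional convergence is required.
\<close>

definition norm_series :: "'i set \<Rightarrow> ('i \<Rightarrow> nat) \<Rightarrow> ('i \<Rightarrow> 'h::banach) \<Rightarrow> 'h \<Rightarrow> bool"
  where "norm_series J pos g f \<longleftrightarrow> (\<lambda>n. \<Sum>j | j \<in> J \<and> pos j < n. g j) \<longlonglongrightarrow> f"

text \<open>Families indexed by \<open>J\<close> are elements of the extensional product \<^const>\<open>PiE\<close>, so that
  uniqueness concerns only their values on \<open>J\<close>.\<close>

definition f_expansion ::
    "'i set \<Rightarrow> ('i \<Rightarrow> nat) \<Rightarrow> ('i \<Rightarrow> 'h::banach set) \<Rightarrow> 'h \<Rightarrow> ('i \<Rightarrow> 'h) \<Rightarrow> bool"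
  where "f_expansion J pos W f g \<longleftrightarrow> g \<in> PiE J W \<and> norm_series J pos g f"

definition f_basis ::
    "('k::real_normed_field \<Rightarrow> 'h::banach \<Rightarrow> 'h) \<Rightarrow> 'i set \<Rightarrow> ('i \<Rightarrow> nat) \<Rightarrow> ('i \<Rightarrow> 'h set) \<Rightarrow> bool"
  where "f_basis smul J pos W \<longleftrightarrow>
    (\<forall>j\<in>J. module.subspace smul (W j) \<and> closed (W j)) \<and>
    (\<forall>f. \<exists>!g. f_expansion J pos W f g)"

definition f_dual ::
    "'i set \<Rightarrow> ('i \<Rightarrow> nat) \<Rightarrow> ('i \<Rightarrow> 'h::banach set) \<Rightarrow> 'i \<Rightarrow> 'h \<Rightarrow> 'h"
  where "f_dual J pos W j f = (THE g. f_expansion J pos W f g) j"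

end

(* The canonical norm p f = sup_n |S_n f| of the partial sums S_n f of the expansion of f is a countably
   subadditive seminorm: if the series of u_m and of p u_m converge, the coefficients of the u_m add up
   to coefficients of the limit, and these do give an expansion of it because the tails are dominated
   by p u_m.  By Zabreiko's lemma, a consequence of the Baire category theorem, p is bounded by a
   multiple of the norm; hence so are the differences P_j of consecutive partial sums. *)
theory Submission
  imports Defs
begin

section \<open>Zabreiko's lemma\<close>

text \<open>A finite sum is a series padded with zeros, and \<open>p 0 = 0\<close> keeps the padding
  from contributing to the series of \<open>p\<close>-values.\<close>

lemma countably_subadditive_triangle:
  fixes p :: "'a::real_normed_vector \<Rightarrow> real"
  assumes "p 0 = 0"
    and csub: "\<And>u. summable u \<Longrightarrow> summable (\<lambda>n. p (u n)) \<Longrightarrow> p (suminf u) \<le> (\<Sum>n. p (u n))"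
  shows "p (x + y) \<le> p x + p y"
proof -
  define u where "u n = (if n = 0 then x else if n = 1 then y else 0)" for n :: nat
  have u: "summable u" "suminf u = x + y"
    using suminf_finite[of "{0,1}" u] summable_finite[of "{0,1}" u] by (auto simp: u_def)
  have pu: "summable (\<lambda>n. p (u n))" "(\<Sum>n. p (u n)) = p x + p y"
    using suminf_finite[of "{0,1}" "\<lambda>n. p (u n)"] summable_finite[of "{0,1}" "\<lambda>n. p (u n)"] assms(1)
    by (auto simp: u_def)
  show ?thesis
    using csub[OF u(1) pu(1)] u(2) pu(2) by simp
qed

text \<open>Baire gives a sublevel set of \<open>p\<close> that is dense in some ball; symmetry and
  convexity move that ball to the origin. Successive approximation then writes each vector of the
  ball as a series with geometrically decreasing \<open>p\<close>-values, and countable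
  subadditivity bounds \<open>p\<close> at the vector itself rather than at nearby points.\<close>

theorem zabreiko:
  fixes p :: "'a::banach \<Rightarrow> real"
  assumes scale: "\<And>c x. p (c *\<^sub>R x) = \<bar>c\<bar> * p x"
    and csub: "\<And>u. summable u \<Longrightarrow> summable (\<lambda>n. p (u n)) \<Longrightarrow> p (suminf u) \<le> (\<Sum>n. p (u n))"
  obtains K where "\<And>x. p x \<le> K * norm x"
proof -
  have p0: "p 0 = 0"
    using scale[of 0 0] by simp
  have tri: "p (x + y) \<le> p x + p y" for x y
    using countably_subadditive_triangle[of p, OF p0 csub] by blast
  have minus: "p (- x) = p x" for x
    using scale[of "-1" x] by simp
  have nonneg: "0 \<le> p x" for x
    using tri[of x "- x"] by (simp add: p0 minus)
  \<comment> \<open>Since \<open>p\<close> has finite values, the sublevel sets cover the space, so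
    by Baire their closures cannot all have empty interior.\<close>
  have "\<exists>k::nat. interior (closure {x. p x \<le> real (Suc k)}) \<noteq> {}"
  proof (rule ccontr)
    assume none: "\<not> ?thesis"
    have "euclidean interior_of (\<Union>k. closure {x. p x \<le> real (Suc k)}) = {}"
    proof (rule Baire_category_alt)
      fix T
      assume "T \<in> range (\<lambda>k. closure {x. p x \<le> real (Suc k)})"
      then obtain k where T: "T = closure {x. p x \<le> real (Suc k)}"
        by (rule rangeE)
      show "closedin euclidean T \<and> euclidean interior_of T = {}"
        using none unfolding T euclidean_interior_of closed_closedin[symmetric] by blast
    qed (simp_all add: completely_metrizable_space_euclidean)
    moreover have "x \<in> (\<Union>k. closure {x. p x \<le> real (Suc k)})" for x
    proof -
      obtain k where "p x \<le> real k"
        using real_arch_simple by blast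
      then have "x \<in> closure {x. p x \<le> real (Suc k)}"
        by (intro subsetD[OF closure_subset]) simp
      then show ?thesis
        by blast
    qed
    then have "(\<Union>k. closure {x. p x \<le> real (Suc k)}) = UNIV"
      by blast
    ultimately show False
      by simp
  qed
  then obtain k :: nat and x0 where "x0 \<in> interior (closure {x. p x \<le> real (Suc k)})"
    by blast
  then obtain r where r: "r > 0" "ball x0 r \<subseteq> closure {x. p x \<le> real (Suc k)}"
    using mem_interior by blast
  define c where "c = real (Suc k)"
  have "c > 0"
    by (simp add: c_def)
  \<comment> \<open>Approximate \<open>x0 + z\<close> by \<open>a\<close> and \<open>x0 - z\<close>
    by \<open>b\<close>: in half of \<open>a - b\<close> the centre \<open>x0\<close> cancels,
    leaving an approximation of \<open>z\<close>, and the triangle inequality keeps its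
    \<open>p\<close>-value at most \<open>c\<close>.\<close>
  have near: "\<exists>a. p a \<le> c \<and> norm (z - a) < e" if z: "norm z < r" and e: "e > 0" for z e
  proof -
    have "x0 + z \<in> closure {x. p x \<le> c}" "x0 - z \<in> closure {x. p x \<le> c}"
      using r(2) z by (auto simp: c_def dist_norm)
    then obtain a b where ab: "p a \<le> c" "dist a (x0 + z) < e" "p b \<le> c" "dist b (x0 - z) < e"
      using e unfolding closure_approachable by blast
    define d where "d = (1/2) *\<^sub>R (a + (- b))"
    have "p d \<le> c"
      using tri[of a "- b"] ab unfolding d_def scale minus by simp
    moreover have "z - d = (1/2) *\<^sub>R ((x0 + z - a) - (x0 - z - b))"
      by (simp add: d_def algebra_simps flip: scaleR_add_left)
    then have "norm (z - d) \<le> (1/2) * (norm (x0 + z - a) + norm (x0 - z - b))"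
      using norm_triangle_ineq4[of "x0 + z - a" "x0 - z - b"] by simp
    then have "norm (z - d) < e"
      using ab by (simp add: dist_norm norm_minus_commute)
    ultimately show ?thesis
      by blast
  qed
  \<comment> \<open>This is \<open>near\<close> rescaled by \<open>2 ^ n\<close>, with error
    \<open>r / 2\<close> so that the remainder lands in the next smaller ball. The implication stays
    under the quantifier so that a total choice function \<open>A\<close> can be extracted.\<close>
  have step: "\<exists>a. norm y < r / 2 ^ n \<longrightarrow> p a \<le> c / 2 ^ n \<and> norm (y - a) < r / 2 ^ Suc n"
    for y and n :: nat
  proof (cases "norm y < r / 2 ^ n")
    case True
    then have "norm ((2 ^ n) *\<^sub>R y) < r"
      by (simp add: field_simps)
    then obtain a where a: "p a \<le> c" "norm ((2 ^ n) *\<^sub>R y - a) < r / 2"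
      using near[of "(2 ^ n) *\<^sub>R y" "r / 2"] r(1) by auto
    have "y - (1 / 2 ^ n) *\<^sub>R a = (1 / 2 ^ n) *\<^sub>R ((2 ^ n) *\<^sub>R y - a)"
      by (simp add: algebra_simps)
    then have "norm (y - (1 / 2 ^ n) *\<^sub>R a) = (1 / 2 ^ n) * norm ((2 ^ n) *\<^sub>R y - a)"
      by simp
    also have "\<dots> < r / 2 ^ Suc n"
      using a(2) by (simp add: field_simps)
    finally have "norm (y - (1 / 2 ^ n) *\<^sub>R a) < r / 2 ^ Suc n" .
    moreover have "p ((1 / 2 ^ n) *\<^sub>R a) \<le> c / 2 ^ n"
      using a(1) by (simp add: scale divide_right_mono)
    ultimately show ?thesis
      by blast
  qed auto
  then obtain A where A: "\<And>y n. norm y < r / 2 ^ n \<Longrightarrow> p (A y n) \<le> c / 2 ^ n"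
      "\<And>y n. norm y < r / 2 ^ n \<Longrightarrow> norm (y - A y n) < r / 2 ^ Suc n"
    by metis
  have bound: "p y \<le> 2 * c" if "norm y < r" for y
  proof -
    \<comment> \<open>\<open>Y n\<close> is the remainder after \<open>n\<close> approximations and
      \<open>u n\<close> the piece removed next; the pieces telescope to \<open>y\<close>.\<close>
    define Y where "Y = rec_nat y (\<lambda>n z. z - A z n)"
    define u where "u n = A (Y n) n" for n
    have Y: "Y 0 = y" "Y (Suc n) = Y n - u n" for n
      by (simp_all add: Y_def u_def)
    have Yb: "norm (Y n) < r / 2 ^ n" for n
    proof (induction n)
      case (Suc n)
      then show ?case
        using A(2)[OF Suc] by (simp only: Y u_def)
    qed (use that in \<open>simp add: Y\<close>)
    have "Y \<longlonglongrightarrow> 0"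
    proof (rule Lim_null_comparison)
      show "\<forall>\<^sub>F n in sequentially. norm (Y n) \<le> r / 2 ^ n"
        using Yb by (intro always_eventually allI less_imp_le)
      show "(\<lambda>n. r / 2 ^ n) \<longlonglongrightarrow> 0"
        using tendsto_mult_right_zero[OF LIMSEQ_power_zero[of "1/2::real"], of r]
        by (simp add: power_divide)
    qed
    moreover have "(\<Sum>i<n. u i) = y - Y n" for n
      by (induction n) (simp_all add: Y)
    ultimately have sums: "u sums y"
      using tendsto_diff[OF tendsto_const[of y], of Y 0] by (simp add: sums_def)
    have geo: "(\<lambda>n. c / 2 ^ n) sums (2 * c)"
      using sums_mult[OF geometric_sums[of "1/2::real"], of c] by (simp add: power_divide mult.commute)
    have pu: "p (u n) \<le> c / 2 ^ n" for n
      using A(1)[OF Yb] by (simp add: u_def)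
    then have summ: "summable (\<lambda>n. p (u n))"
      by (intro summable_comparison_test'[OF sums_summable[OF geo]]) (simp add: nonneg)
    have "p y \<le> (\<Sum>n. p (u n))"
      using csub[OF sums_summable[OF sums] summ] sums_unique[OF sums] by simp
    also have "\<dots> \<le> (\<Sum>n. c / 2 ^ n)"
      by (rule suminf_le[OF pu summ sums_summable[OF geo]])
    finally show ?thesis
      using sums_unique[OF geo] by simp
  qed
  have "p x \<le> (4 * c / r) * norm x" for x
  proof (cases "x = 0")
    case False
    \<comment> \<open>The factor shrinks or stretches \<open>x\<close> to norm \<open>r / 2\<close>,
      strictly inside the ball where \<open>bound\<close> applies.\<close>
    define s where "s = r / (2 * norm x)"
    have "s > 0" "norm (s *\<^sub>R x) < r"
      using False r(1) by (simp_all add: s_def)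
    then have "s * p x \<le> 2 * c"
      using bound[of "s *\<^sub>R x"] by (simp add: scale)
    then show ?thesis
      using False r(1) by (simp add: s_def field_simps)
  qed (simp add: p0)
  then show ?thesis
    using that by blast
qed

section \<open>The dual sequence of an f-basis\<close>

text \<open>Boundedness is a matter of the real structure alone. The scalars of the Hilbert space
  return through \<open>dual_map\<close>, applied to multiplication by a fixed scalar.\<close>

locale real_f_basis =
  fixes J :: "'i set" and pos :: "'i \<Rightarrow> nat" and W :: "'i \<Rightarrow> 'h::banach set"
  assumes inj: "inj_on pos J"
    and subspace: "j \<in> J \<Longrightarrow> subspace (W j)"
    and closed: "j \<in> J \<Longrightarrow> closed (W j)"
    and ex1: "\<exists>!g. f_expansion J pos W f g"
begin

section \<open>Algebra of the coefficient maps\<close>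

abbreviation P where "P \<equiv> f_dual J pos W"

definition partial_sum :: "('i \<Rightarrow> 'h) \<Rightarrow> nat \<Rightarrow> 'h"
  where "partial_sum g n = (\<Sum>j | j \<in> J \<and> pos j < n. g j)"

lemma norm_series_iff: "norm_series J pos g f \<longleftrightarrow> partial_sum g \<longlonglongrightarrow> f"
  unfolding norm_series_def partial_sum_def ..

text \<open>Injectivity of \<open>pos\<close> embeds these indices into the first \<open>n\<close>
  naturals. Finiteness matters because a sum over an infinite set is 0 by convention.\<close>

lemma finite_index: "finite {j. j \<in> J \<and> pos j < n}"
proof (rule finite_imageD)
  show "finite (pos ` {j. j \<in> J \<and> pos j < n})"
    by (rule finite_subset[of _ "{..<n}"]) auto
  show "inj_on pos {j. j \<in> J \<and> pos j < n}"
    using inj by (rule inj_on_subset) auto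
qed

lemma expansion_dual: "f_expansion J pos W f (THE g. f_expansion J pos W f g)"
  by (rule theI'[OF ex1])

lemma dual_in: "j \<in> J \<Longrightarrow> P j f \<in> W j"
  using expansion_dual[of f] unfolding f_expansion_def f_dual_def by (auto simp: PiE_mem)

lemma dual_tendsto: "partial_sum (\<lambda>j. P j f) \<longlonglongrightarrow> f"
  using expansion_dual[of f] unfolding f_expansion_def f_dual_def norm_series_iff by simp

text \<open>Uniqueness as a working rule: identities for \<open>P\<close> follow by exhibiting
  coefficients. Restricting \<open>g\<close> to \<open>J\<close> makes it extensional, as
  \<open>f_expansion\<close> demands, without changing any partial sum.\<close>

lemma dual_eqI:
  assumes "\<And>i. i \<in> J \<Longrightarrow> g i \<in> W i" "partial_sum g \<longlonglongrightarrow> f" "j \<in> J"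
  shows "P j f = g j"
proof -
  have "partial_sum (restrict g J) = partial_sum g"
    by (auto simp: partial_sum_def fun_eq_iff intro!: sum.cong)
  then have "f_expansion J pos W f (restrict g J)"
    using assms by (auto simp: f_expansion_def norm_series_iff)
  then have "(THE g. f_expansion J pos W f g) = restrict g J"
    by (rule the1_equality[OF ex1])
  then show ?thesis
    using assms(3) by (simp add: f_dual_def)
qed

text \<open>By linearity and continuity, applying \<open>T\<close> termwise to the expansion of
  \<open>f\<close> gives an expansion of \<open>T f\<close>.\<close>

lemma dual_map:
  assumes T: "bounded_linear T" and "\<And>i. i \<in> J \<Longrightarrow> T ` W i \<subseteq> W i" and "j \<in> J"
  shows "P j (T f) = T (P j f)"
proof (rule dual_eqI)
  have "partial_sum (\<lambda>j. T (P j f)) = (\<lambda>n. T (partial_sum (\<lambda>j. P j f) n))"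
    by (simp add: partial_sum_def linear_sum[OF bounded_linear.linear[OF T]] fun_eq_iff)
  then show "partial_sum (\<lambda>j. T (P j f)) \<longlonglongrightarrow> T f"
    using bounded_linear.tendsto[OF T dual_tendsto] by simp
qed (use assms dual_in in blast)+

lemma dual_add: "j \<in> J \<Longrightarrow> P j (f + g) = P j f + P j g"
proof (rule dual_eqI)
  have "partial_sum (\<lambda>j. P j f + P j g) = (\<lambda>n. partial_sum (\<lambda>j. P j f) n + partial_sum (\<lambda>j. P j g) n)"
    by (simp add: partial_sum_def sum.distrib fun_eq_iff)
  then show "partial_sum (\<lambda>j. P j f + P j g) \<longlonglongrightarrow> f + g"
    using tendsto_add[OF dual_tendsto dual_tendsto] by simp
qed (use subspace subspace_add dual_in in blast)+

lemma dual_scaleR: "j \<in> J \<Longrightarrow> P j (c *\<^sub>R f) = c *\<^sub>R P j f"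
  using subspace by (intro dual_map bounded_linear_scaleR_right) (auto intro: subspace_scale)

lemma dual_of_mem:
  assumes "i \<in> J" "j \<in> J" "x \<in> W j"
  shows "P i x = (if i = j then x else 0)"
proof (rule dual_eqI)
  \<comment> \<open>The bound on positions is strict, so the index \<open>j\<close> enters the
    partial sum at \<open>Suc (pos j)\<close>; from there on the sum is constant.\<close>
  have "partial_sum (\<lambda>i. if i = j then x else 0) n = x" if "n \<ge> Suc (pos j)" for n
    using that assms(2) finite_index[of n] by (simp add: partial_sum_def)
  then show "partial_sum (\<lambda>i. if i = j then x else 0) \<longlonglongrightarrow> x"
    by (intro tendsto_eventually eventually_sequentiallyI)
qed (use assms subspace subspace_0 in auto)

section \<open>The canonical norm\<close>

abbreviation S where "S f \<equiv> partial_sum (\<lambda>j. P j f)"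

definition canonical_norm :: "'h \<Rightarrow> real"
  where "canonical_norm f = (SUP n. norm (S f n))"

text \<open>Convergent sequences are bounded. This makes the supremum defining
  \<open>canonical_norm\<close> a genuine upper bound.\<close>

lemma bdd_above_S: "bdd_above (range (\<lambda>n. norm (S f n)))"
proof -
  have "Bseq (S f)"
    using dual_tendsto convergent_imp_Bseq convergentI by blast
  then show ?thesis
    by (auto simp: Bseq_def bdd_above_def)
qed

lemma norm_S_le: "norm (S f n) \<le> canonical_norm f"
  unfolding canonical_norm_def by (rule cSUP_upper[OF _ bdd_above_S]) simp

lemma canonical_norm_leI: "(\<And>n. norm (S f n) \<le> B) \<Longrightarrow> canonical_norm f \<le> B"
  unfolding canonical_norm_def by (rule cSUP_least) auto

lemma norm_le_canonical_norm: "norm f \<le> canonical_norm f"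
  using norm_S_le by (intro LIMSEQ_le_const2[OF tendsto_norm[OF dual_tendsto]]) auto

lemma norm_dual_le:
  assumes "j \<in> J"
  shows "norm (P j f) \<le> 2 * canonical_norm f"
proof -
  \<comment> \<open>By injectivity \<open>j\<close> is the only index at its position, so raising
    the bound by one adds exactly the term at \<open>j\<close>.\<close>
  have "{i. i \<in> J \<and> pos i < Suc (pos j)} = insert j {i. i \<in> J \<and> pos i < pos j}"
    using assms inj by (auto simp: less_Suc_eq inj_on_def)
  then have "P j f = S f (Suc (pos j)) - S f (pos j)"
    using finite_index[of "pos j"] by (simp add: partial_sum_def)
  then have "norm (P j f) \<le> norm (S f (Suc (pos j))) + norm (S f (pos j))"
    by (simp add: norm_triangle_ineq4)
  then show ?thesis
    using norm_S_le[of f "Suc (pos j)"] norm_S_le[of f "pos j"] by simp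
qed

lemma canonical_norm_scaleR: "canonical_norm (c *\<^sub>R f) = \<bar>c\<bar> * canonical_norm f"
proof -
  have S: "S (c *\<^sub>R f) n = c *\<^sub>R S f n" for c f n
    by (simp add: partial_sum_def dual_scaleR scaleR_sum_right)
  have le: "canonical_norm (c *\<^sub>R f) \<le> \<bar>c\<bar> * canonical_norm f" for c f
    by (rule canonical_norm_leI) (simp add: S mult_left_mono norm_S_le)
  show ?thesis
  proof (cases "c = 0")
    case True
    have "0 \<le> canonical_norm 0"
      using norm_le_canonical_norm[of 0] by simp
    then show ?thesis
      using True le[of 0 f] by simp
  next
    case False
    \<comment> \<open>The reverse inequality is \<open>le\<close> applied to the inverse
      scalar.\<close>
    have "canonical_norm f \<le> \<bar>inverse c\<bar> * canonical_norm (c *\<^sub>R f)"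
      using le[of "inverse c" "c *\<^sub>R f"] False by simp
    then have "\<bar>c\<bar> * canonical_norm f \<le> canonical_norm (c *\<^sub>R f)"
      using False by (simp add: field_simps)
    with le[of c f] show ?thesis
      by simp
  qed
qed

lemma canonical_norm_suminf_le:
  assumes "summable u" and pu: "summable (\<lambda>m. canonical_norm (u m))"
  shows "canonical_norm (suminf u) \<le> (\<Sum>m. canonical_norm (u m))"
proof -
  \<comment> \<open>These are the candidate coefficients of \<open>suminf u\<close>; on
    \<open>J\<close> the series converge absolutely, being dominated by twice the canonical norms of
    the terms.\<close>
  define g where "g j = (\<Sum>m. P j (u m))" for j
  have summ: "summable (\<lambda>m. P j (u m))" if "j \<in> J" for j
    by (rule summable_comparison_test'[OF summable_mult[OF pu, of 2]]) (rule norm_dual_le[OF that])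
  have normS: "summable (\<lambda>m. norm (S (u m) n))" for n
    by (rule summable_comparison_test'[OF pu]) (simp add: norm_S_le)
  have "S (u m) n = (\<Sum>j | j \<in> J \<and> pos j < n. P j (u m))" for m n
    by (simp add: partial_sum_def)
  then have partial_g: "partial_sum g n = (\<Sum>m. S (u m) n)" for n
    using suminf_sum[of "{j. j \<in> J \<and> pos j < n}" "\<lambda>j m. P j (u m)"] summ
    by (simp add: partial_sum_def g_def)
  \<comment> \<open>Dominated convergence for series (Tannery): for each \<open>m\<close> the error
    of the \<open>n\<close>-th partial sum of \<open>u m\<close> tends to 0, with the summable bound
    \<open>2 * canonical_norm (u m)\<close> uniform in \<open>n\<close>.\<close>
  have "(\<lambda>n. partial_sum g n - suminf u) \<longlonglongrightarrow> 0"
  proof (rule Lim_null_comparison)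
    have bound: "norm (S (u m) n - u m) \<le> 2 * canonical_norm (u m)" for m n
      using norm_triangle_ineq4[of "S (u m) n" "u m"] norm_S_le[of "u m" n] norm_le_canonical_norm[of "u m"]
      by linarith
    have diff: "summable (\<lambda>m. norm (S (u m) n - u m))" for n
      by (rule summable_comparison_test'[OF summable_mult[OF pu, of 2]]) (simp add: bound)
    have "partial_sum g n - suminf u = (\<Sum>m. S (u m) n - u m)" for n
      using suminf_diff[OF summable_norm_cancel[OF normS] assms(1)] by (simp add: partial_g)
    then show "\<forall>\<^sub>F n in sequentially. norm (partial_sum g n - suminf u) \<le> (\<Sum>m. norm (S (u m) n - u m))"
      using summable_norm[OF diff] by simp
    have lim: "(\<lambda>n. norm (S (u m) n - u m)) \<longlonglongrightarrow> 0" for m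
      using tendsto_norm_zero[OF LIM_zero[OF dual_tendsto]] .
    from tannerys_theorem[of "\<lambda>m n. norm (S (u m) n - u m)", OF lim _ summable_mult[OF pu, of 2]]
    show "(\<lambda>n. \<Sum>m. norm (S (u m) n - u m)) \<longlonglongrightarrow> 0"
      using bound by (simp add: case_prod_unfold)
  qed
  then have lim: "partial_sum g \<longlonglongrightarrow> suminf u"
    by (rule LIM_zero_cancel)
  \<comment> \<open>Closedness of \<open>W j\<close> enters here: \<open>g j\<close> is a limit of
    finite sums of elements of \<open>W j\<close>.\<close>
  have "g j \<in> W j" if "j \<in> J" for j
  proof (rule closed_sequentially[OF closed[OF that]])
    show "(\<lambda>n. \<Sum>m<n. P j (u m)) \<longlonglongrightarrow> g j"
      unfolding g_def by (rule summable_LIMSEQ[OF summ[OF that]])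
    show "(\<Sum>m<n. P j (u m)) \<in> W j" for n
      by (intro subspace_sum subspace dual_in that)
  qed
  then have "P j (suminf u) = g j" if "j \<in> J" for j
    using lim that by (intro dual_eqI) auto
  then have S_sum: "S (suminf u) n = (\<Sum>m. S (u m) n)" for n
    unfolding partial_g[symmetric] by (simp add: partial_sum_def)
  show ?thesis
  proof (rule canonical_norm_leI)
    fix n
    have "norm (S (suminf u) n) \<le> (\<Sum>m. norm (S (u m) n))"
      unfolding S_sum by (rule summable_norm[OF normS])
    also have "\<dots> \<le> (\<Sum>m. canonical_norm (u m))"
      using suminf_le[OF norm_S_le normS pu] .
    finally show "norm (S (suminf u) n) \<le> (\<Sum>m. canonical_norm (u m))" .
  qed
qed

lemma dual_bounded:
  assumes "j \<in> J"
  shows "\<exists>K. \<forall>f. norm (P j f) \<le> K * norm f"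
proof -
  obtain K where K: "\<And>f. canonical_norm f \<le> K * norm f"
    using zabreiko[of canonical_norm, OF canonical_norm_scaleR canonical_norm_suminf_le] by blast
  have "norm (P j f) \<le> (2 * K) * norm f" for f
    using norm_dual_le[OF assms, of f] K[of f] by simp
  then show ?thesis
    by blast
qed

end

section \<open>Scalar multiplication in a Hilbert space\<close>

lemma norm_sconj: "norm (sconj z) = norm z"
  by (simp add: sconj_def norm_divide norm_mult power2_eq_square)

context hilbert_space
begin

text \<open>Only real multiples are tied to the norm by axiom; for general \<open>a\<close> the
  inner product decides. Pulling \<open>a\<close> out of both slots of
  \<open>ip (smul a x) (smul a x)\<close> yields the factor \<open>norm a\<close> twice, as
  \<open>sconj\<close> preserves norms.\<close>

lemma norm_smul: "norm (smul a x) = norm a * norm x"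
proof -
  have norm_ip_self: "norm (ip y y) = (norm y)\<^sup>2" for y
    by (simp add: ip_self norm_power)
  have "ip (smul a x) (smul a x) = a * sconj (ip (smul a x) x)"
    using ip_commute by (metis ip_smul_left)
  then have "norm (ip (smul a x) (smul a x)) = norm a * (norm a * norm (ip x x))"
    by (simp only: norm_mult norm_sconj ip_smul_left)
  then have "(norm (smul a x))\<^sup>2 = (norm a * norm x)\<^sup>2"
    by (simp add: norm_ip_self power2_eq_square)
  then show ?thesis
    by simp
qed

lemma bounded_linear_smul: "bounded_linear (smul a)"
proof (rule bounded_linear_intro)
  show "smul a (x + y) = smul a x + smul a y" for x y
    by (rule scale_right_distrib)
  show "smul a (r *\<^sub>R x) = r *\<^sub>R smul a x" for r x
    by (metis scale_left_commute smul_of_real)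
  show "norm (smul a x) \<le> norm x * norm a" for x
    by (simp add: norm_smul)
qed

lemma real_subspace:
  assumes "module.subspace smul V"
  shows "Real_Vector_Spaces.subspace V"
proof -
  have "r *\<^sub>R x \<in> V" if "x \<in> V" for r x
    using subspace_scale[OF assms that, of "of_real r"] by (simp add: smul_of_real)
  then show ?thesis
    using subspace_0[OF assms] subspace_add[OF assms]
    by (intro real_vector.subspaceI) auto
qed

end

theorem theorem2p6:
  fixes smul :: "'k::real_normed_field \<Rightarrow> 'h::banach \<Rightarrow> 'h"
    and ip :: "'h \<Rightarrow> 'h \<Rightarrow> 'k"
    and J :: "'i set"
    and pos :: "'i \<Rightarrow> nat"
    and W :: "'i \<Rightarrow> 'h set"
  assumes "hilbert_space smul ip"
    and "separable (UNIV :: 'h set)"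
    and "inj_on pos J"
    and "f_basis smul J pos W"
  shows "(\<forall>j\<in>J. f_dual J pos W j \<in> bounded_operators smul (W j)) \<and>
    (\<forall>i\<in>J. \<forall>j\<in>J. f_dual J pos W i \<circ> f_dual J pos W j =
      (if i = j then f_dual J pos W j else (\<lambda>f. 0)))"
proof -
  interpret hilbert_space smul ip
    by fact
  have sub: "module.subspace smul (W j)" if "j \<in> J" for j
    using assms(4) that by (simp add: f_basis_def)
  interpret B: real_f_basis J pos W
    using assms(3,4) real_subspace by unfold_locales (auto simp: f_basis_def)
  have "f_dual J pos W j \<in> bounded_operators smul (W j)" if "j \<in> J" for j
  proof -
    \<comment> \<open>Multiplication by \<open>a\<close> is a bounded real-linear map preserving
      every \<open>W i\<close>, so it commutes with the coefficient maps.\<close>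
    have "f_dual J pos W j (smul a x) = smul a (f_dual J pos W j x)" for a x
      using sub subspace_scale that by (intro B.dual_map bounded_linear_smul) auto
    then have "Vector_Spaces.linear smul smul (f_dual J pos W j)"
      using B.dual_add[OF that] by unfold_locales auto
    then show ?thesis
      using B.dual_in[OF that] B.dual_bounded[OF that] by (auto simp: bounded_operators_def)
  qed
  \<comment> \<open>The inner map takes values in \<open>W j\<close>, where the expansion is a
    single term.\<close>
  moreover have "f_dual J pos W i \<circ> f_dual J pos W j = (if i = j then f_dual J pos W j else (\<lambda>f. 0))"
    if "i \<in> J" "j \<in> J" for i j
    using B.dual_of_mem[OF that] B.dual_in[OF that(2)] by (auto simp: fun_eq_iff)
  ultimately show ?thesis
    by blast
qed

end
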